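(* $r'_2(6)=18$.
   Context: All graphs are finite and simple. A threshold graph of order $s$ is an $s$-vertex graph that can be constructed from the one-vertex graph by repeatedly adding a new vertex that is either adjacent to all the previous vertices or nonadjacent to all the previous vertices. For a positive integer $s$, $r'_2(s)$ is the minimum integer $n$ such that every $n$-vertex graph contains a threshold graph of order $s$ as an induced subgraph. *)

theory Defs
  imports "Graph_Theory.Graph_Theory"
begin

text \<open>
  Finite simple graphs are the symmetric loop-free digraphs \<^locale>\<open>pair_graph\<close>: an edge between
  u and v is represented by the two arcs (u, v) and (v, u).
\<close>

inductive threshold_graph :: "'a pair_pre_digraph \<Rightarrow> bool" where
  single: "threshold_graph \<lparr> pverts = {v}, parcs = {} \<rparr>"
| add_isolated: "threshold_graph G \<Longrightarrow> v \<notin> pverts G \<Longrightarrow>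
    threshold_graph \<lparr> pverts = insert v (pverts G), parcs = parcs G \<rparr>"
| add_dominating: "threshold_graph G \<Longrightarrow> v \<notin> pverts G \<Longrightarrow>
    threshold_graph \<lparr> pverts = insert v (pverts G),
                      parcs = parcs G \<union> {v} \<times> pverts G \<union> pverts G \<times> {v} \<rparr>"

text \<open>
  Being a threshold graph is invariant under isomorphism, so no isomorphism is needed here.
\<close>

definition contains_induced_threshold :: "'a pair_pre_digraph \<Rightarrow> nat \<Rightarrow> bool" where
  "contains_induced_threshold G s \<longleftrightarrow>
     (\<exists>H. threshold_graph H \<and> card (pverts H) = s \<and>
          induced_subgraph (with_proj H) (with_proj G))"

text \<open>
  Every finite graph is isomorphic to one whose vertices are natural numbers, so
  quantifying over graphs with vertices in \<^typ>\<open>nat\<close> covers all n-vertex graphs.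
\<close>

definition r2' :: "nat \<Rightarrow> nat" where
  "r2' s = (LEAST n. \<forall>G :: nat pair_pre_digraph.
     pair_graph G \<and> card (pverts G) = n \<longrightarrow> contains_induced_threshold G s)"

end

theory Submission
  imports Defs
begin

text \<open>
  Call a graph \<open>T\<^sub>k\<close>-free if it has no induced threshold graph of order \<open>k\<close>. A vertex of a
  \<open>T\<^sub>k\<^sub>+\<^sub>1\<close>-free graph has a \<open>T\<^sub>k\<close>-free neighbourhood and a \<open>T\<^sub>k\<close>-free set of non-neighbours, and the
  notion is invariant under complementation. Every 3-vertex graph is threshold, so a \<open>T\<^sub>4\<close>-free
  graph has at most 5 vertices, and is the 5-cycle if it has exactly 5. A \<open>T\<^sub>5\<close>-free graph on 9
  vertices is 4-regular; double counting the edges between the neighbours and the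
  non-neighbours of a vertex shows that adjacent vertices have exactly one common neighbour (the
  graph is the Paley graph on 9 vertices), and this forces that there is no induced 5-cycle. It
  also follows that a \<open>T\<^sub>5\<close>-free graph has at most 9 vertices.

  Let now \<open>G\<close> be \<open>T\<^sub>6\<close>-free on 18 vertices. Up to complementation some vertex \<open>v\<close> has exactly 9
  neighbours, forming a set \<open>N\<close>. A non-neighbour \<open>m\<close> of \<open>v\<close> has a \<open>T\<^sub>4\<close>-free set of non-neighbours in
  \<open>N\<close>, hence at most 4 of them and at least 5 neighbours in \<open>N\<close>: at least 40 edges leave \<open>N\<close> towards
  the 8 non-neighbours of \<open>v\<close>. But a vertex of \<open>N\<close> has degree at most 9, is adjacent to \<open>v\<close> and to 4
  vertices of \<open>N\<close>, so at most 36 such edges exist. The Paley graph on 17 vertices is \<open>T\<^sub>6\<close>-free.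
\<close>

section \<open>Sets containing an induced threshold graph\<close>

text \<open>Leaving out \<open>v\<close> itself makes \<open>nb (compl_rel E) v S\<close> the set of
  proper non-neighbours, so the diagonal of \<open>E\<close> never matters.\<close>

definition nb :: "('a \<Rightarrow> 'a \<Rightarrow> bool) \<Rightarrow> 'a \<Rightarrow> 'a set \<Rightarrow> 'a set" where
  "nb E v S = {u \<in> S. u \<noteq> v \<and> E v u}"

abbreviation (input) compl_rel :: "('a \<Rightarrow> 'a \<Rightarrow> bool) \<Rightarrow> 'a \<Rightarrow> 'a \<Rightarrow> bool" where
  "compl_rel E \<equiv> (\<lambda>u v. \<not> E u v)"

text \<open>
  \<open>thr E n S\<close>: the relation \<open>E\<close> induces a threshold graph of order \<open>n\<close> on some subset of \<open>S\<close>. The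
  recursion peels off the vertex added last.
\<close>

fun thr :: "('a \<Rightarrow> 'a \<Rightarrow> bool) \<Rightarrow> nat \<Rightarrow> 'a set \<Rightarrow> bool" where
  "thr E 0 S \<longleftrightarrow> True"
| "thr E (Suc n) S \<longleftrightarrow> (\<exists>v\<in>S. thr E n (nb E v S) \<or> thr E n (nb (compl_rel E) v S))"

lemma symp_compl_rel: "symp E \<Longrightarrow> symp (compl_rel E)"
  by (auto simp: symp_def)

lemma nb_subset: "nb E v S \<subseteq> S"
  by (auto simp: nb_def)

lemma nb_mono: "S \<subseteq> S' \<Longrightarrow> nb E v S \<subseteq> nb E v S'"
  by (auto simp: nb_def)

lemma finite_nb [simp]: "finite S \<Longrightarrow> finite (nb E v S)"
  by (simp add: nb_def)

lemma thr_compl_rel: "thr (compl_rel E) n S \<longleftrightarrow> thr E n S"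
  by (induction n arbitrary: S) auto

lemma thr_mono: "thr E n S \<Longrightarrow> S \<subseteq> S' \<Longrightarrow> thr E n S'"
proof (induction n arbitrary: S S')
  case (Suc n)
  then obtain v where v: "v \<in> S" "thr E n (nb E v S) \<or> thr E n (nb (compl_rel E) v S)"
    by auto
  then have "thr E n (nb E v S') \<or> thr E n (nb (compl_rel E) v S')"
    using Suc.IH nb_mono[OF Suc.prems(2)] by blast
  then show ?case using v(1) Suc.prems(2) by auto
qed simp

lemma thr_SucI: "v \<in> S \<Longrightarrow> thr E n (nb E v S) \<Longrightarrow> thr E (Suc n) S"
  and thr_SucI': "v \<in> S \<Longrightarrow> thr E n (nb (compl_rel E) v S) \<Longrightarrow> thr E (Suc n) S"
  by auto

lemma card_nb_compl:
  assumes "finite S" "v \<in> S"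
  shows "card (nb E v S) + card (nb (compl_rel E) v S) + 1 = card S"
proof -
  have "S = insert v (nb E v S \<union> nb (compl_rel E) v S)"
    using assms(2) by (auto simp: nb_def)
  moreover have "v \<notin> nb E v S \<union> nb (compl_rel E) v S"
    "nb E v S \<inter> nb (compl_rel E) v S = {}"
    by (auto simp: nb_def)
  ultimately show ?thesis
    using assms(1) card_Un_disjoint[of "nb E v S" "nb (compl_rel E) v S"]
    by (metis Suc_eq_plus1 card_insert_disjoint finite_Un finite_insert finite_nb)
qed

lemma not_thr_nb:
  assumes "\<not> thr E (Suc n) S" "v \<in> S"
  shows "\<not> thr E n (nb E v S)" "\<not> thr E n (nb (compl_rel E) v S)"
  using assms by auto

text \<open>Pigeonhole: the at least \<open>2 * k - 1\<close> other vertices include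
  \<open>k\<close> neighbours or \<open>k\<close> non-neighbours of any chosen vertex.\<close>

lemma thr_double:
  assumes "\<And>S'. S' \<subseteq> S \<Longrightarrow> k \<le> card S' \<Longrightarrow> thr E n S'" and "finite S" "2 * k \<le> card S" "0 < k"
  shows "thr E (Suc n) S"
proof -
  obtain v where v: "v \<in> S" using assms(3,4) by fastforce
  then have "k \<le> card (nb E v S) \<or> k \<le> card (nb (compl_rel E) v S)"
    using card_nb_compl[OF assms(2) v, of E] assms(3) by linarith
  then show ?thesis
    using thr_SucI[OF v] thr_SucI'[OF v] assms(1) nb_subset by metis
qed

lemma thr_1: "finite S \<Longrightarrow> 1 \<le> card S \<Longrightarrow> thr E 1 S"
  by (cases "S = {}") auto

declare thr.simps [simp del]

lemma thr_2: "finite S \<Longrightarrow> 2 \<le> card S \<Longrightarrow> thr E 2 S"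
proof -
  assume S: "finite S" "2 \<le> card S"
  have "thr E (Suc 1) S"
    using S by (intro thr_double[of S 1] thr_1) (auto intro: rev_finite_subset)
  then show ?thesis by (simp add: numeral_2_eq_2)
qed

text \<open>Three truth values cannot be pairwise different, so some vertex of a triple is joined to
  both others or to neither.\<close>

lemma thr_3:
  assumes "symp E" "finite S" "3 \<le> card S"
  shows "thr E 3 S"
proof -
  obtain T where "T \<subseteq> S" "card T = 3" using assms(3) by (meson obtain_subset_with_card_n)
  then obtain a b c where abc: "{a, b, c} \<subseteq> S" "a \<noteq> b" "a \<noteq> c" "b \<noteq> c"
    by (auto simp: card_3_iff)
  have hub: "thr E 3 S" if "{x, y, z} \<subseteq> S" "x \<noteq> y" "x \<noteq> z" "y \<noteq> z" "E x y = E x z" for x y z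
  proof -
    have "thr E 2 {y, z}" using that by (intro thr_2) auto
    moreover have "{y, z} \<subseteq> nb E x S \<or> {y, z} \<subseteq> nb (compl_rel E) x S"
      using that by (auto simp: nb_def)
    ultimately have "thr E 2 (nb E x S) \<or> thr E 2 (nb (compl_rel E) x S)"
      using thr_mono by blast
    then have "thr E (Suc 2) S" using that(1) thr_SucI[of x S E 2] thr_SucI'[of x S E 2] by blast
    then show ?thesis by simp
  qed
  show ?thesis
    using hub[of a b c] hub[of b a c] hub[of c a b] abc sympD[OF assms(1)] by blast
qed

lemma thr_4:
  assumes "symp E" "finite S" "6 \<le> card S"
  shows "thr E 4 S"
proof -
  have "thr E (Suc 3) S"
    using assms by (intro thr_double[of S 3] thr_3) (auto intro: rev_finite_subset)
  then show ?thesis by simp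
qed

section \<open>\<open>T\<^sub>4\<close>-free sets\<close>

lemma card_nb_T4_free:
  assumes "symp E" "finite S" "\<not> thr E 4 S" "v \<in> S"
  shows "card (nb E v S) \<le> 2" "card (nb (compl_rel E) v S) \<le> 2"
proof -
  have "\<not> thr E (Suc 3) S" using assms(3) by simp
  note * = not_thr_nb[OF this assms(4)]
  have "\<not> 3 \<le> card (nb E v S)" "\<not> 3 \<le> card (nb (compl_rel E) v S)"
    using * thr_3[OF assms(1) finite_nb[OF assms(2)]] by blast+
  then show "card (nb E v S) \<le> 2" "card (nb (compl_rel E) v S) \<le> 2"
    by linarith+
qed

lemma card_nb_T4_free_5:
  assumes "symp E" "card S = 5" "\<not> thr E 4 S" "v \<in> S"
  shows "card (nb E v S) = 2"
proof -
  have "finite S" using assms(2) card.infinite by fastforce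
  then show ?thesis
    using card_nb_T4_free[OF assms(1) _ assms(3,4)] card_nb_compl[of S v E] assms(2,4) by simp
qed

lemma card_filter_sum: "finite A \<Longrightarrow> card {u \<in> A. P u} = (\<Sum>u\<in>A. of_bool (P u))"
  by (simp add: sum_of_bool_eq Int_def)

text \<open>Turns 2-regularity into an equation between 0/1 values that a case distinction can
  solve.\<close>

lemma count_nb_T4_free_5:
  assumes "symp E" "\<not> thr E 4 S" "S = {x, p, q, r, s}" "distinct [x, p, q, r, s]"
  shows "of_bool (E x p) + of_bool (E x q) + of_bool (E x r) + of_bool (E x s) = (2 :: nat)"
proof -
  have "2 = card (nb E x S)"
    using card_nb_T4_free_5[OF assms(1) _ assms(2), of x] assms(3,4) by simp
  also have "nb E x S = {u \<in> {p, q, r, s}. E x u}"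
    using assms(3,4) by (auto simp: nb_def)
  also have "card \<dots> = (\<Sum>u\<in>{p, q, r, s}. of_bool (E x u))"
    by (rule card_filter_sum) simp
  finally show ?thesis using assms(4) by (simp del: sum_of_bool_eq add: add.assoc)
qed

text \<open>Take a vertex \<open>a\<close> with neighbours \<open>b\<close>, \<open>e\<close> and
  non-neighbours \<open>c\<close>, \<open>d\<close>. The degree equations leave open only whether
  \<open>b\<close> continues to \<open>c\<close> or to \<open>d\<close>.\<close>

lemma five_cycle:
  assumes "symp E" "card S = 5" "\<not> thr E 4 S"
  obtains a b c d e where "S = {a, b, c, d, e}" "distinct [a, b, c, d, e]"
    "E a b" "E b c" "E c d" "E d e" "E e a"
    "\<not> E a c" "\<not> E b d" "\<not> E c e" "\<not> E d a" "\<not> E e b"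
proof -
  note two = card_nb_T4_free_5[OF assms]
  have fin: "finite S" using assms(2) card.infinite by fastforce
  have sym: "E x y = E y x" for x y using sympD[OF assms(1)] by blast
  obtain a where a: "a \<in> S" using assms(2) by fastforce
  obtain b e where be: "nb E a S = {b, e}" "b \<noteq> e" using two[OF a] by (auto simp: card_2_iff)
  have "card (nb (compl_rel E) a S) = 2"
    using card_nb_compl[OF fin a, of E] two[OF a] assms(2) by simp
  then obtain c d where cd: "nb (compl_rel E) a S = {c, d}" "c \<noteq> d" by (auto simp: card_2_iff)
  have S: "S = {a, b, c, d, e}"
  proof -
    have "S = insert a (nb E a S \<union> nb (compl_rel E) a S)" using a by (auto simp: nb_def)
    then show ?thesis using be cd by auto
  qed
  have dist: "distinct [a, b, c, d, e]" 
    by (rule card_distinct) (use S assms(2) in simp)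
  have ab: "E a b" "E a e" "\<not> E a c" "\<not> E a d"
  proof -
    have "b \<in> nb E a S" "e \<in> nb E a S" "c \<in> nb (compl_rel E) a S" "d \<in> nb (compl_rel E) a S"
      using be cd by auto
    then show "E a b" "E a e" "\<not> E a c" "\<not> E a d" by (auto simp: nb_def)
  qed
  note count = count_nb_T4_free_5[OF assms(1,3)]
  have "of_bool (E b a) + of_bool (E b c) + of_bool (E b d) + of_bool (E b e) = (2 :: nat)"
    by (rule count) (use S dist in auto)
  then have nbb: "of_bool (E b c) + of_bool (E b d) + of_bool (E b e) = (1 :: nat)"
    using ab sym[of b a] by simp
  have "of_bool (E e a) + of_bool (E e b) + of_bool (E e c) + of_bool (E e d) = (2 :: nat)"
    by (rule count) (use S dist in auto)
  then have nbe: "of_bool (E b e) + of_bool (E c e) + of_bool (E d e) = (1 :: nat)"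
    using ab sym[of e] by simp
  have "of_bool (E c a) + of_bool (E c b) + of_bool (E c d) + of_bool (E c e) = (2 :: nat)"
    by (rule count) (use S dist in auto)
  then have nbc: "of_bool (E b c) + of_bool (E c d) + of_bool (E c e) = (2 :: nat)"
    using ab sym[of c a] sym[of c b] by simp
  have "of_bool (E d a) + of_bool (E d b) + of_bool (E d c) + of_bool (E d e) = (2 :: nat)"
    by (rule count) (use S dist in auto)
  then have nbd: "of_bool (E b d) + of_bool (E c d) + of_bool (E d e) = (2 :: nat)"
    using ab sym[of d a] sym[of d b] sym[of d c] by simp
  have flip: "E e a" "\<not> E c a" "\<not> E d a" "E e b = E b e" "E d c = E c d"
    using ab sym by blast+
  show thesis
  proof (cases "E b c")
    case True
    then have "E c d \<and> E d e \<and> \<not> E b d \<and> \<not> E c e \<and> \<not> E b e"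
      using nbb nbc nbd nbe
      by (cases "E b d"; cases "E b e"; cases "E c d"; cases "E c e"; cases "E d e") simp_all
    then show thesis using that[OF S dist] True ab flip by simp
  next
    case False
    then have "E c d \<and> E c e \<and> E b d \<and> \<not> E d e \<and> \<not> E b e"
      using nbb nbc nbd nbe
      by (cases "E b d"; cases "E b e"; cases "E c d"; cases "E c e"; cases "E d e") simp_all
    moreover have "S = {a, b, d, c, e}" "distinct [a, b, d, c, e]" using S dist by auto
    ultimately show thesis using that[of a b d c e] False ab flip by simp
  qed
qed

text \<open>Both vertices can be added to \<open>X\<close>, in an order depending on
  \<open>E v u\<close>: if adjacent, first \<open>u\<close> as isolated, then \<open>v\<close> as
  dominating; otherwise first \<open>v\<close>, then \<open>u\<close>.\<close>

lemma thr_Suc_SucI: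
  assumes "symp E" "u \<in> S" "v \<in> S" "u \<noteq> v" "thr E n X" "X \<subseteq> nb E v S" "X \<subseteq> nb (compl_rel E) u S"
  shows "thr E (Suc (Suc n)) S"
proof (cases "E v u")
  case True
  have "X \<subseteq> nb (compl_rel E) u (insert u X)" using assms(6,7) by (auto simp: nb_def)
  from thr_mono[OF assms(5) this] have "thr E (Suc n) (insert u X)" by (rule thr_SucI'[rotated]) simp
  moreover have "insert u X \<subseteq> nb E v S" using assms(2,4,6) True by (simp add: nb_def)
  ultimately show ?thesis using thr_SucI[OF assms(3) thr_mono] by metis
next
  case False
  have "X \<subseteq> nb E v (insert v X)" using assms(6,7) by (auto simp: nb_def)
  from thr_mono[OF assms(5) this] have "thr E (Suc n) (insert v X)" by (rule thr_SucI[rotated]) simp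
  moreover have "\<not> E u v" using False sympD[OF assms(1)] by blast
  then have "insert v X \<subseteq> nb (compl_rel E) u S" using assms(3,4,7) by (simp add: nb_def)
  ultimately show ?thesis using thr_SucI'[OF assms(2) thr_mono] by metis
qed

section \<open>\<open>T\<^sub>5\<close>-free sets of nine vertices\<close>

lemma not_thr_4_nb:
  assumes "\<not> thr E 5 S" "v \<in> S"
  shows "\<not> thr E 4 (nb E v S)"
proof -
  have "\<not> thr E (Suc 4) S" using assms(1) by simp
  then show ?thesis using not_thr_nb assms(2) by metis
qed

text \<open>Clause form for \<open>sat\<close>: three of five hold iff no three fail
  together.\<close>

lemma three_of_five:
  "3 \<le> (of_bool a + of_bool b + of_bool c + of_bool d + of_bool e :: nat) \<longleftrightarrow>
    (a \<or> b \<or> c) \<and> (a \<or> b \<or> d) \<and> (a \<or> b \<or> e) \<and> (a \<or> c \<or> d) \<and> (a \<or> c \<or> e) \<and>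
    (a \<or> d \<or> e) \<and> (b \<or> c \<or> d) \<and> (b \<or> c \<or> e) \<and> (b \<or> d \<or> e) \<and> (c \<or> d \<or> e)"
  by (cases a; cases b; cases c; cases d; cases e; simp)

text \<open>A larger neighbourhood would be a 5-cycle \<open>C\<close>, leaving a set
  \<open>W\<close> of three non-neighbours. The constraints on the edges between \<open>C\<close>
  and \<open>W\<close> contradict each other.\<close>

lemma degree_le_4:
  assumes "symp E" "card S = 9" "\<not> thr E 5 S" "v \<in> S"
  shows "card (nb E v S) \<le> 4"
proof (rule ccontr)
  assume gt: "\<not> card (nb E v S) \<le> 4"
  have fin: "finite S" using assms(2) card.infinite by fastforce
  have sym: "E x y = E y x" for x y using sympD[OF assms(1)] by blast
  define C where "C = nb E v S"
  define W where "W = nb (compl_rel E) v S"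
  have C4: "\<not> thr E 4 C" unfolding C_def using not_thr_4_nb[OF assms(3,4)] .
  then have "card C = 5"
    using thr_4[OF assms(1), of C] gt finite_nb[OF fin, of E v] unfolding C_def by linarith
  then have "card W = 3" using card_nb_compl[OF fin assms(4), of E] assms(2) by (simp add: C_def W_def)
  then obtain w x y where W: "W = {w, x, y}" "w \<noteq> x" "w \<noteq> y" "x \<noteq> y"
    by (auto simp: card_3_iff)
  obtain a b c d e where C: "C = {a, b, c, d, e}" and dist: "distinct [a, b, c, d, e]"
    and cyc: "E a b" "E b c" "E c d" "E d e" "E e a"
      "\<not> E a c" "\<not> E b d" "\<not> E c e" "\<not> E d a" "\<not> E e b"
    using five_cycle[OF assms(1) \<open>card C = 5\<close> C4] by metis
  have CD: "t \<in> S" "t \<noteq> v" "E v t" if "t \<in> C" for t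
    using that by (auto simp: C_def nb_def)
  have WD: "t \<in> S" "t \<noteq> v" "\<not> E v t" if "t \<in> W" for t
    using that by (auto simp: W_def nb_def)
  have no5: "\<not> thr E (Suc (Suc 3)) S" using assms(3) by simp
  \<comment> \<open>The members of \<open>C\<close> not adjacent to \<open>u\<close> are dominated
    by \<open>v\<close> and isolated from \<open>u\<close>, so \<open>thr_Suc_SucI\<close> allows at
    most two of them.\<close>
  have ge3: "3 \<le> (of_bool (E u a) + of_bool (E u b) + of_bool (E u c) + of_bool (E u d)
      + of_bool (E u e) :: nat)" if u: "u \<in> W" for u
  proof -
    let ?X = "{t \<in> C. \<not> E u t}"
    have "?X \<subseteq> nb E v S" "?X \<subseteq> nb (compl_rel E) u S"
      using CD WD[OF u] by (auto simp: nb_def)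
    then have "\<not> thr E 3 ?X" using thr_Suc_SucI[OF assms(1) WD(1)[OF u] assms(4)] WD(2)[OF u] no5 by blast
    then have "\<not> 3 \<le> card ?X" using thr_3[OF assms(1)] C by force
    moreover have "card ?X + card {t \<in> C. E u t} = card C"
      using C by (subst card_Un_disjoint[symmetric]) (auto intro: arg_cong[where f = card])
    ultimately have "3 \<le> card {t \<in> C. E u t}" using \<open>card C = 5\<close> by linarith
    also have "\<dots> = (\<Sum>t\<in>C. of_bool (E u t))" using C by (intro card_filter_sum) simp
    finally show ?thesis using C dist by (simp del: sum_of_bool_eq add: add.assoc)
  qed
  \<comment> \<open>Otherwise \<open>t\<close> dominates all of \<open>W\<close>, from which
    \<open>v\<close> is isolated.\<close>
  have le2: "\<not> (E w t \<and> E x t \<and> E y t)" if t: "t \<in> C" for t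
  proof
    assume *: "E w t \<and> E x t \<and> E y t"
    have "thr E 3 W" using thr_3[OF assms(1), of W] \<open>card W = 3\<close> W by simp
    moreover have "W \<subseteq> nb E t S" "W \<subseteq> nb (compl_rel E) v S"
      using * W(1) WD CD[OF t] sym[of t] by (auto simp: nb_def)
    ultimately show False
      using thr_Suc_SucI[OF assms(1) assms(4) CD(1)[OF t]] CD(2)[OF t] no5 by blast
  qed
  have two: "E f p \<noteq> E f q \<and> E g p \<noteq> E g q \<and> E f p \<noteq> E g p"
    if h: "h \<in> C" "p \<in> C" "q \<in> C" "E h p" "E h q" "\<not> E p q" "p \<noteq> q" "p \<noteq> h" "q \<noteq> h"
      "f \<in> W" "g \<in> W" "f \<noteq> g" "E f h" "E g h" for f g h p q
  proof -
    have ne: "h \<noteq> f" "h \<noteq> g" "p \<noteq> f" "p \<noteq> g" "q \<noteq> f" "q \<noteq> g"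
      using CD(3)[OF h(1)] CD(3)[OF h(2)] CD(3)[OF h(3)] WD(3)[OF h(10)] WD(3)[OF h(11)] by auto
    have "{v, p, q, f, g} \<subseteq> nb E h S"
      using h(4,5,8,9,13,14) ne(1,2) CD[OF h(1)] CD(1)[OF h(2)] CD(1)[OF h(3)] WD(1)[OF h(10)]
        WD(1)[OF h(11)] assms(4) sym[of h] by (simp add: nb_def)
    then have no4: "\<not> thr E 4 {v, p, q, f, g}"
      using not_thr_4_nb[OF assms(3) CD(1)[OF h(1)]] thr_mono by blast
    have d: "distinct [v, p, q, f, g]"
      using ne h(7,12) CD(2)[OF h(2)] CD(2)[OF h(3)] WD(2)[OF h(10)] WD(2)[OF h(11)] by simp
    note count = count_nb_T4_free_5[OF assms(1) no4]
    have "of_bool (E p v) + of_bool (E p q) + of_bool (E p f) + of_bool (E p g) = (2 :: nat)"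
      by (rule count) (use d in auto)
    then have "of_bool (E p f) + of_bool (E p g) = (1 :: nat)"
      using CD[OF h(2)] h(6) sym[of p v] by simp
    moreover have "of_bool (E q v) + of_bool (E q p) + of_bool (E q f) + of_bool (E q g) = (2 :: nat)"
      by (rule count) (use d in auto)
    then have "of_bool (E q f) + of_bool (E q g) = (1 :: nat)"
      using CD[OF h(3)] h(6) sym[of q v] sym[of q p] by simp
    moreover have "of_bool (E f v) + of_bool (E f p) + of_bool (E f q) + of_bool (E f g) = (2 :: nat)"
      by (rule count) (use d in auto)
    then have "of_bool (E p f) + of_bool (E q f) + of_bool (E f g) = (2 :: nat)"
      using WD(3)[OF h(10)] sym[of f v] sym[of f p] sym[of f q] by simp
    moreover have "of_bool (E g v) + of_bool (E g p) + of_bool (E g q) + of_bool (E g f) = (2 :: nat)"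
      by (rule count) (use d in auto)
    then have "of_bool (E p g) + of_bool (E q g) + of_bool (E f g) = (2 :: nat)"
      using WD(3)[OF h(11)] sym[of g v] sym[of g p] sym[of g q] sym[of g f] by simp
    ultimately have "E p f \<noteq> E q f \<and> E p g \<noteq> E q g \<and> E p f \<noteq> E p g"
      by (cases "E p f"; cases "E q f"; cases "E p g"; cases "E q g"; cases "E f g") simp_all
    then show ?thesis using sym by blast
  qed
  \<comment> \<open>\<open>h\<close> has the neighbours \<open>v, p, q, f, g\<close>, which form a 5-cycle; \<open>v\<close> is adjacent to \<open>p\<close> and \<open>q\<close>.
    The resulting conditions around the cycle \<open>C\<close> are contradictory.\<close>
  define Q where "Q f g h p q \<longleftrightarrow> (E f h \<and> E g h \<longrightarrow> E f p \<noteq> E f q \<and> E g p \<noteq> E g q \<and> E f p \<noteq> E g p)"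
    for f g h p q
  have Q: "Q w x h p q \<and> Q w y h p q \<and> Q x y h p q"
    if "h \<in> C" "p \<in> C" "q \<in> C" "E h p" "E h q" "\<not> E p q" "p \<noteq> q" "p \<noteq> h" "q \<noteq> h" for h p q
    unfolding Q_def using two[OF that, of w x] two[OF that, of w y] two[OF that, of x y] W by blast
  have inC: "a \<in> C" "b \<in> C" "c \<in> C" "d \<in> C" "e \<in> C" using C by auto
  \<comment> \<open>Reversed copies supply the disequalities and edges in both orientations.\<close>
  have dist': "distinct [e, d, c, b, a]" using dist by auto
  have cyc': "E b a" "E c b" "E d c" "E e d" "E a e" using cyc sym by blast+
  have "w \<in> W" "x \<in> W" "y \<in> W" using W by auto
  note ge = this[THEN ge3]
  have Qa: "Q w x a b e" "Q w y a b e" "Q x y a b e"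
    using Q[of a b e] inC dist dist' cyc cyc' sym[of b e] by simp_all
  have Qb: "Q w x b a c" "Q w y b a c" "Q x y b a c"
    using Q[of b a c] inC dist dist' cyc cyc' by simp_all
  have Qc: "Q w x c b d" "Q w y c b d" "Q x y c b d"
    using Q[of c b d] inC dist dist' cyc cyc' by simp_all
  have Qd: "Q w x d c e" "Q w y d c e" "Q x y d c e"
    using Q[of d c e] inC dist dist' cyc cyc' by simp_all
  have Qe: "Q w x e d a" "Q w y e d a" "Q x y e d a"
    using Q[of e d a] inC dist dist' cyc cyc' by simp_all
  \<comment> \<open>The only propositional atoms left are the fifteen adjacencies between
    \<open>W\<close> and \<open>C\<close>.\<close>
  show False
    using ge Qa Qb Qc Qd Qe inC[THEN le2] unfolding Q_def three_of_five by sat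
qed

text \<open>The upper bound also holds in the complement, and the eight other vertices must split
  evenly.\<close>

lemma degree_eq_4:
  assumes "symp E" "card S = 9" "\<not> thr E 5 S" "v \<in> S"
  shows "card (nb E v S) = 4"
proof -
  have "card (nb (compl_rel E) v S) \<le> 4"
    using degree_le_4[OF symp_compl_rel[OF assms(1)]] assms by (simp add: thr_compl_rel)
  moreover have "finite S" using assms(2) card.infinite by fastforce
  ultimately show ?thesis
    using degree_le_4[OF assms] card_nb_compl[of S v E] assms(2,4) by simp
qed

section \<open>Common neighbours and induced 5-cycles\<close>

lemma sum_card_nb:
  assumes "symp E" "finite A" "finite B" "A \<inter> B = {}"
  shows "(\<Sum>a\<in>A. card (nb E a B)) = (\<Sum>b\<in>B. card (nb E b A))"
proof -
  have *: "card (nb E a B) = (\<Sum>b\<in>B. of_bool (E a b))" if "a \<notin> B" "finite B" for a B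
  proof -
    have "nb E a B = {b \<in> B. E a b}" using that(1) by (auto simp: nb_def)
    then show ?thesis using card_filter_sum[OF that(2), of "E a"] by simp
  qed
  have "(\<Sum>a\<in>A. card (nb E a B)) = (\<Sum>a\<in>A. \<Sum>b\<in>B. of_bool (E a b))"
    using assms(3,4) by (intro sum.cong *) auto
  also have "\<dots> = (\<Sum>b\<in>B. \<Sum>a\<in>A. of_bool (E b a))"
    using sympD[OF assms(1)] by (subst sum.swap) (intro sum.cong refl arg_cong[where f = of_bool], blast)
  also have "\<dots> = (\<Sum>b\<in>B. card (nb E b A))"
    using assms(2,4) by (intro sum.cong *[symmetric]) auto
  finally show ?thesis .
qed

text \<open>Both \<open>N\<close> and \<open>M\<close> have four vertices. A vertex of
  \<open>M\<close> has at most 2 neighbours in \<open>M\<close>, hence at least 2 in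
  \<open>N\<close>. A vertex of \<open>N\<close> has at least 1 neighbour in \<open>N\<close> and is
  adjacent to \<open>u\<close>, hence has at most 2 in \<open>M\<close>. Counting the edges between
  them gives at least 8 and at most 8, so equality holds throughout.\<close>

lemma card_common_nb:
  assumes "symp E" "card S = 9" "\<not> thr E 5 S" "u \<in> S" "v \<in> nb E u S"
  shows "card (nb E v (nb E u S)) = 1"
proof (rule ccontr)
  assume neq1: "card (nb E v (nb E u S)) \<noteq> 1"
  define N where "N = nb E u S"
  define M where "M = nb (compl_rel E) u S"
  have fin: "finite S" using assms(2) card.infinite by fastforce
  then have finNM: "finite N" "finite M" unfolding N_def M_def by simp_all
  have sym: "E x y = E y x" for x y using sympD[OF assms(1)] by blast
  have deg: "card (nb E x S) = 4" if "x \<in> S" for x using degree_eq_4[OF assms(1-3) that] .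
  have cards: "card N = 4" "card M = 4"
    using deg[OF assms(4)] card_nb_compl[OF fin assms(4), of E] assms(2) by (simp_all add: N_def M_def)
  have N4: "\<not> thr E 4 N" unfolding N_def using not_thr_4_nb[OF assms(3,4)] .
  have M4: "\<not> thr E 4 M"
    unfolding M_def using not_thr_4_nb[of "compl_rel E" S u] assms(3,4) by (simp add: thr_compl_rel)
  have NM: "N \<inter> M = {}" "S = insert u (N \<union> M)" "u \<notin> N" "u \<notin> M"
    using assms(4) by (auto simp: N_def M_def nb_def)
  have N: "1 \<le> card (nb E x N) \<and> card (nb E x M) + card (nb E x N) = 3" if x: "x \<in> N" for x
  proof
    show "1 \<le> card (nb E x N)"
      using card_nb_T4_free(2)[OF assms(1) finNM(1) N4 x] card_nb_compl[OF finNM(1) x, of E] cards by simp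
    have "x \<in> S" "x \<noteq> u" "E u x" using x by (auto simp: N_def nb_def)
    then have "nb E x S = insert u (nb E x M \<union> nb E x N)"
      using NM(2) sym[of x u] by (auto simp: nb_def)
    moreover have "u \<notin> nb E x M \<union> nb E x N" "nb E x M \<inter> nb E x N = {}"
      using NM by (auto simp: nb_def)
    ultimately show "card (nb E x M) + card (nb E x N) = 3"
      using deg[OF \<open>x \<in> S\<close>] finNM by (simp add: card_Un_disjoint)
  qed
  have M: "2 \<le> card (nb E x N)" if x: "x \<in> M" for x
  proof -
    have "x \<in> S" "\<not> E x u" using x sym[of x u] by (auto simp: M_def nb_def)
    then have "nb E x S = nb E x M \<union> nb E x N"
      using NM(2) by (auto simp: nb_def)
    moreover have "nb E x M \<inter> nb E x N = {}"
      using NM by (auto simp: nb_def)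
    ultimately have "card (nb E x M) + card (nb E x N) = 4"
      using deg[OF \<open>x \<in> S\<close>] finNM by (simp add: card_Un_disjoint)
    then show ?thesis using card_nb_T4_free(1)[OF assms(1) finNM(2) M4 x] by linarith
  qed
  have "v \<in> N" using assms(5) by (simp add: N_def)
  have "8 \<le> (\<Sum>y\<in>M. card (nb E y N))"
    using sum_bounded_below[of M "2 :: nat" "\<lambda>y. card (nb E y N)"] M cards by simp
  also have "\<dots> = (\<Sum>x\<in>N. card (nb E x M))"
    using sum_card_nb[OF assms(1) finNM NM(1)] by simp
  also have "\<dots> < (\<Sum>x\<in>N. 2)"
  proof (rule sum_strict_mono_ex1)
    show "\<forall>x\<in>N. card (nb E x M) \<le> 2" using N by fastforce
    \<comment> \<open>Here the inequality becomes strict: by assumption \<open>v\<close> has at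
      least 2 neighbours in \<open>N\<close>.\<close>
    have "card (nb E v M) < 2" using N[OF \<open>v \<in> N\<close>] neq1[folded N_def] by linarith
    then show "\<exists>x\<in>N. card (nb E x M) < 2" using \<open>v \<in> N\<close> by blast
  qed (rule finNM)
  finally have "8 < (\<Sum>x\<in>N. 2 :: nat)" .
  then show False using cards by simp
qed

text \<open>On an induced 5-cycle each edge has a common neighbour outside the cycle. These five are
  distinct, but only four vertices lie outside.\<close>

lemma thr_4_of_5_subset:
  assumes "symp E" "card S = 9" "\<not> thr E 5 S" "C \<subseteq> S" "card C = 5"
  shows "thr E 4 C"
proof (rule ccontr)
  assume "\<not> thr E 4 C"
  then obtain a b c d e where C: "C = {a, b, c, d, e}" and dist: "distinct [a, b, c, d, e]"
    and cyc: "E a b" "E b c" "E c d" "E d e" "E e a"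
      "\<not> E a c" "\<not> E b d" "\<not> E c e" "\<not> E d a" "\<not> E e b"
    using five_cycle[OF assms(1,5)] by metis
  have fin: "finite S" using assms(2) card.infinite by fastforce
  have sym: "E x y = E y x" for x y using sympD[OF assms(1)] by blast
  have inC: "a \<in> S" "b \<in> S" "c \<in> S" "d \<in> S" "e \<in> S" using C assms(4) by auto
  have ex: "\<exists>t\<in>S. t \<noteq> x \<and> t \<noteq> y \<and> E x t \<and> E y t"
    if "x \<in> S" "y \<in> S" "x \<noteq> y" "E x y" for x y
  proof -
    have "card (nb E y (nb E x S)) = 1"
      using that by (intro card_common_nb[OF assms(1-3)]) (auto simp: nb_def)
    then obtain t where "t \<in> nb E y (nb E x S)" by (auto simp: card_1_singleton_iff)
    then show ?thesis by (auto simp: nb_def)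
  qed
  \<comment> \<open>otherwise \<open>x\<close> and \<open>z\<close> are two common neighbours of the adjacent vertices \<open>y\<close> and \<open>t\<close>\<close>
  have third: "\<not> E z t"
    if "x \<in> C" "y \<in> C" "z \<in> C" "distinct [x, y, z]" "E x y" "E y z" "t \<in> S - C" "E x t" "E y t"
    for x y z t
  proof
    assume *: "E z t"
    have "card (nb E t (nb E y S)) = 1"
      using that assms(4) * by (intro card_common_nb[OF assms(1-3)]) (auto simp: nb_def)
    moreover have "{x, z} \<subseteq> nb E t (nb E y S)"
      using that assms(4) * sym[of t x] sym[of t z] sym[of y x] by (auto simp: nb_def)
    ultimately have "card {x, z} \<le> 1" using card_mono[OF finite_nb[OF finite_nb[OF fin]]] by metis
    then show False using \<open>distinct [x, y, z]\<close> by simp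
  qed
  obtain p where p: "p \<in> S" "p \<noteq> a" "p \<noteq> b" "E a p" "E b p" using ex[of a b] inC dist cyc by auto
  obtain q where q: "q \<in> S" "q \<noteq> b" "q \<noteq> c" "E b q" "E c q" using ex[of b c] inC dist cyc by auto
  obtain r where r: "r \<in> S" "r \<noteq> c" "r \<noteq> d" "E c r" "E d r" using ex[of c d] inC dist cyc by auto
  obtain s where s: "s \<in> S" "s \<noteq> d" "s \<noteq> e" "E d s" "E e s" using ex[of d e] inC dist cyc by auto
  obtain t where t: "t \<in> S" "t \<noteq> e" "t \<noteq> a" "E e t" "E a t" using ex[of e a] inC dist cyc by auto
  \<comment> \<open>An induced 5-cycle contains no triangle.\<close>
  have "p \<notin> C" using p cyc sym C by auto
  moreover have "q \<notin> C" using q cyc sym C by auto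
  moreover have "r \<notin> C" using r cyc sym C by auto
  moreover have "s \<notin> C" using s cyc sym C by auto
  moreover have "t \<notin> C" using t cyc sym C by auto
  ultimately have SC: "p \<in> S - C" "q \<in> S - C" "r \<in> S - C" "s \<in> S - C" "t \<in> S - C"
    using p q r s t by auto
  have dist': "distinct [e, d, c, b, a]" using dist by auto
  have inC': "a \<in> C" "b \<in> C" "c \<in> C" "d \<in> C" "e \<in> C" using C by auto
  have cyc': "E b a" "E c b" "E d c" "E e d" "E a e" using cyc sym by blast+
  \<comment> \<open>The two cycle vertices next to the edge of \<open>p\<close>, \<open>q\<close>,
    \<open>r\<close> or \<open>s\<close> are not adjacent to it; these non-adjacencies tell the five
    common neighbours apart.\<close>
  have "\<not> E c p"
    by (rule third[of a b]) (use inC' dist dist' cyc cyc' p SC in simp_all)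
  moreover have "\<not> E e p"
    by (rule third[of b a]) (use inC' dist dist' cyc cyc' p SC in simp_all)
  moreover have "\<not> E d q"
    by (rule third[of b c]) (use inC' dist dist' cyc cyc' q SC in simp_all)
  moreover have "\<not> E a q"
    by (rule third[of c b]) (use inC' dist dist' cyc cyc' q SC in simp_all)
  moreover have "\<not> E e r"
    by (rule third[of c d]) (use inC' dist dist' cyc cyc' r SC in simp_all)
  moreover have "\<not> E b r"
    by (rule third[of d c]) (use inC' dist dist' cyc cyc' r SC in simp_all)
  moreover have "\<not> E a s"
    by (rule third[of d e]) (use inC' dist dist' cyc cyc' s SC in simp_all)
  moreover have "\<not> E c s"
    by (rule third[of e d]) (use inC' dist dist' cyc cyc' s SC in simp_all)
  ultimately have "distinct [p, q, r, s, t]" using q(4,5) r(4,5) s(4,5) t(4,5) by auto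
  then have "card {p, q, r, s, t} = 5" by simp
  moreover have "card {p, q, r, s, t} \<le> card (S - C)" using SC fin by (intro card_mono) auto
  moreover have "card (S - C) = 4"
    using assms(2,4,5) fin by (simp add: card_Diff_subset finite_subset)
  ultimately show False by simp
qed

text \<open>Among ten vertices, deleting a neighbour of \<open>v\<close> keeps its non-neighbours,
  so there are 4 of them; deleting a non-neighbour shows likewise that \<open>v\<close> has 4
  neighbours. That accounts for only nine vertices.\<close>

lemma thr_5:
  assumes "symp E" "finite S" "10 \<le> card S"
  shows "thr E 5 S"
proof (rule ccontr)
  assume not: "\<not> thr E 5 S"
  obtain T where T: "T \<subseteq> S" "card T = 10" using assms(3) by (meson obtain_subset_with_card_n)
  have fin: "finite T" using T assms(2) finite_subset by blast
  have deg: "card (nb E v (T - {x})) = 4" "card (nb (compl_rel E) v (T - {x})) = 4"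
    if "v \<in> T" "x \<in> T" "x \<noteq> v" for v x
  proof -
    have "card (T - {x}) = 9" using T fin that by simp
    moreover have "\<not> thr E 5 (T - {x})" using not T(1) thr_mono by blast
    ultimately show "card (nb E v (T - {x})) = 4" "card (nb (compl_rel E) v (T - {x})) = 4"
      using degree_eq_4[OF assms(1)] degree_eq_4[OF symp_compl_rel[OF assms(1)]] that
      by (simp_all add: thr_compl_rel)
  qed
  obtain v where v: "v \<in> T" using T(2) by fastforce
  \<comment> \<open>A first deletion shows that \<open>v\<close> has both a neighbour and a
    non-neighbour.\<close>
  obtain x0 where x0: "x0 \<in> T" "x0 \<noteq> v"
  proof -
    have "card (T - {v}) = 9" using T fin v by simp
    then have "T - {v} \<noteq> {}" by fastforce
    then show thesis using that by blast
  qed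
  have "nb E v (T - {x0}) \<noteq> {}" "nb (compl_rel E) v (T - {x0}) \<noteq> {}"
    using deg[OF v x0] by fastforce+
  then obtain x y where x: "x \<in> T" "x \<noteq> v" "E v x" and y: "y \<in> T" "y \<noteq> v" "\<not> E v y"
    by (auto simp: nb_def)
  have "nb (compl_rel E) v (T - {x}) = nb (compl_rel E) v T" "nb E v (T - {y}) = nb E v T"
    using x y by (auto simp: nb_def)
  then have "card (nb (compl_rel E) v T) = 4" "card (nb E v T) = 4"
    using deg[OF v x(1,2)] deg[OF v y(1,2)] by simp_all
  then show False using card_nb_compl[OF fin v, of E] T(2) by simp
qed

section \<open>Eighteen vertices\<close>

lemma thr_6_of_degree_9:
  assumes "symp E" "card S = 18" "v \<in> S" "card (nb E v S) = 9"
  shows "thr E 6 S"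
proof (rule ccontr)
  assume not: "\<not> thr E 6 S"
  then have no6: "\<not> thr E (Suc (Suc 4)) S" "\<not> thr E (Suc 5) S" by simp_all
  have fin: "finite S" using assms(2) card.infinite by fastforce
  have sym: "E x y = E y x" for x y using sympD[OF assms(1)] by blast
  define N where "N = nb E v S"
  define M where "M = nb (compl_rel E) v S"
  have finNM: "finite N" "finite M" using fin unfolding N_def M_def by simp_all
  have N: "card N = 9" using assms(4) by (simp add: N_def)
  have M: "card M = 8"
    using card_nb_compl[OF fin assms(3), of E] assms(2,4) by (simp add: M_def)
  have NM: "N \<inter> M = {}" "S = insert v (N \<union> M)" "v \<notin> N" "v \<notin> M"
    using assms(3) by (auto simp: N_def M_def nb_def)
  have N5: "\<not> thr E 5 N" unfolding N_def using not_thr_nb(1)[OF no6(2) assms(3)] .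
  have "5 \<le> card (nb E m N)" if m: "m \<in> M" for m
  proof -
    let ?X = "nb (compl_rel E) m N"
    have mS: "m \<in> S" "m \<noteq> v" using m by (auto simp: M_def nb_def)
    \<comment> \<open>\<open>?X\<close> is dominated by \<open>v\<close> and isolated from
      \<open>m\<close>, so \<open>thr_Suc_SucI\<close> applies.\<close>
    have "?X \<subseteq> nb E v S" "?X \<subseteq> nb (compl_rel E) m S"
      using NM(2) by (auto simp: N_def nb_def)
    then have no4: "\<not> thr E 4 ?X" using thr_Suc_SucI[OF assms(1) mS(1) assms(3) mS(2)] no6(1) by blast
    then have "\<not> 6 \<le> card ?X" using thr_4[OF assms(1) finite_nb[OF finNM(1)]] by blast
    \<comment> \<open>Size 5 would make \<open>?X\<close> an induced 5-cycle in the nine-vertex set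
      \<open>N\<close>.\<close>
    moreover have "card ?X \<noteq> 5"
      using thr_4_of_5_subset[OF assms(1) N N5 nb_subset, of "compl_rel E" m] no4 by blast
    moreover have "card (nb E m N) + card ?X = 9"
    proof -
      have "m \<notin> N" using m NM by auto
      then have "nb E m N \<union> ?X = N" "nb E m N \<inter> ?X = {}" by (auto simp: nb_def)
      then show ?thesis using N card_Un_disjoint[of "nb E m N" ?X] finNM(1) by simp
    qed
    ultimately show ?thesis by linarith
  qed
  then have "40 \<le> (\<Sum>m\<in>M. card (nb E m N))"
    using sum_bounded_below[of M "5 :: nat" "\<lambda>m. card (nb E m N)"] M by simp
  also have "\<dots> = (\<Sum>u\<in>N. card (nb E u M))"
    using sum_card_nb[OF assms(1) finNM NM(1)] by simp
  also have "\<dots> \<le> 36"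
  proof -
    have "card (nb E u M) \<le> 4" if u: "u \<in> N" for u
    proof -
      have uS: "u \<in> S" "u \<noteq> v" "E u v" using u sym[of u v] by (auto simp: N_def nb_def)
      have "\<not> thr E 5 (nb E u S)" using not_thr_nb(1)[OF no6(2) uS(1)] .
      then have "card (nb E u S) \<le> 9"
        using thr_5[OF assms(1) finite_nb[OF fin], of E u] by linarith
      moreover have "nb E u S = insert v (nb E u N \<union> nb E u M)"
        using NM(2) uS by (auto simp: nb_def)
      moreover have "v \<notin> nb E u N \<union> nb E u M" "nb E u N \<inter> nb E u M = {}"
        using NM by (auto simp: nb_def)
      ultimately have "card (nb E u N) + card (nb E u M) \<le> 8"
        using finNM by (simp add: card_Un_disjoint)
      then show ?thesis using degree_eq_4[OF assms(1) N N5 u] by linarith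
    qed
    then show ?thesis using sum_bounded_above[of N "\<lambda>u. card (nb E u M)" 4] N by simp
  qed
  finally show False by simp
qed

text \<open>The other 17 vertices split into neighbours and non-neighbours, at most nine of each, so
  one class has exactly nine.\<close>

lemma thr_6:
  assumes "symp E" "card S = 18"
  shows "thr E 6 S"
proof (rule ccontr)
  assume not: "\<not> thr E 6 S"
  then have no6: "\<not> thr E (Suc 5) S" by simp
  have fin: "finite S" using assms(2) card.infinite by fastforce
  obtain v where v: "v \<in> S" using assms(2) by fastforce
  have "\<not> 10 \<le> card (nb E v S)" "\<not> 10 \<le> card (nb (compl_rel E) v S)"
    using thr_5[OF assms(1) finite_nb[OF fin, of _ v]] not_thr_nb[OF no6 v] by blast+
  then have "card (nb E v S) = 9 \<or> card (nb (compl_rel E) v S) = 9"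
    using card_nb_compl[OF fin v, of E] assms(2) by linarith
  then show False
    using thr_6_of_degree_9[OF assms v] thr_6_of_degree_9[OF symp_compl_rel[OF assms(1)] assms(2) v] not
    unfolding thr_compl_rel by blast
qed

section \<open>Relation to graphs, and the Paley graph\<close>

text \<open>Justifies the length test that prunes the search in \<open>thr_list\<close>.\<close>

lemma thr_card: "thr E n S \<Longrightarrow> finite S \<Longrightarrow> n \<le> card S"
proof (induction n arbitrary: S)
  case (Suc n)
  then obtain v where "v \<in> S" "thr E n (nb E v S) \<or> thr E n (nb (compl_rel E) v S)"
    by (auto simp: thr.simps)
  then show ?case
    using Suc.IH[of "nb E v S"] Suc.IH[of "nb (compl_rel E) v S"] Suc.prems(2)
      card_nb_compl[OF Suc.prems(2), of v E] by auto
qed simp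

lemma thr_cong:
  "(\<And>u v. u \<in> S \<Longrightarrow> v \<in> S \<Longrightarrow> E u v = F u v) \<Longrightarrow> thr E n S \<longleftrightarrow> thr F n S"
proof (induction n arbitrary: S)
  case (Suc n)
  have "thr E n (nb E v S) = thr F n (nb F v S) \<and>
      thr E n (nb (compl_rel E) v S) = thr F n (nb (compl_rel F) v S)" if "v \<in> S" for v
  proof -
    have eq: "nb E v S = nb F v S" "nb (compl_rel E) v S = nb (compl_rel F) v S"
      using Suc.prems that by (auto simp: nb_def)
    have "thr E n (nb F v S) = thr F n (nb F v S)"
      by (rule Suc.IH) (auto simp: nb_def Suc.prems)
    moreover have "thr E n (nb (compl_rel F) v S) = thr F n (nb (compl_rel F) v S)"
      by (rule Suc.IH) (auto simp: nb_def Suc.prems)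
    ultimately show ?thesis using eq by simp
  qed
  then show ?case by (auto simp: thr.simps)
qed (simp add: thr.simps)

text \<open>The inclusion of the arcs is carried through the induction because it guarantees that a
  new vertex has no arcs in the old graph.\<close>

lemma threshold_graph_thr:
  "threshold_graph H \<Longrightarrow> finite (pverts H) \<and> parcs H \<subseteq> pverts H \<times> pverts H \<and>
    thr (\<lambda>u v. (u, v) \<in> parcs H) (card (pverts H)) (pverts H)"
proof (induction rule: threshold_graph.induct)
  case (single v)
  then show ?case by (simp add: thr.simps)
next
  case (add_isolated G v)
  let ?E = "\<lambda>u v. (u, v) \<in> parcs G"
  have "nb (compl_rel ?E) v (insert v (pverts G)) = pverts G"
    using add_isolated by (auto simp: nb_def)
  then show ?case using add_isolated by (auto simp: thr.simps)
next
  case (add_dominating G v)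
  let ?F = "\<lambda>u w. (u, w) \<in> parcs G \<union> {v} \<times> pverts G \<union> pverts G \<times> {v}"
  have "nb ?F v (insert v (pverts G)) = pverts G"
    using add_dominating by (auto simp: nb_def)
  moreover have "thr ?F (card (pverts G)) (pverts G)"
    using add_dominating by (subst thr_cong[where F = "\<lambda>u v. (u, v) \<in> parcs G"]) auto
  ultimately show ?case using add_dominating by (auto simp: thr.simps)
qed

lemma thr_threshold_graph:
  assumes "symp (\<lambda>u v. (u, v) \<in> A)"
  shows "thr (\<lambda>u v. (u, v) \<in> A) n S \<Longrightarrow> finite S \<Longrightarrow> n \<noteq> 0 \<Longrightarrow> (\<And>x. (x, x) \<notin> A) \<Longrightarrow>
    \<exists>V\<subseteq>S. card V = n \<and> threshold_graph \<lparr>pverts = V, parcs = A \<inter> V \<times> V\<rparr>"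
proof (induction n arbitrary: S)
  case (Suc n)
  let ?E = "\<lambda>u v. (u, v) \<in> A"
  obtain v where v: "v \<in> S" "thr ?E n (nb ?E v S) \<or> thr ?E n (nb (compl_rel ?E) v S)"
    using Suc.prems(1) by (auto simp: thr.simps)
  show ?case
  \<comment> \<open>\<open>threshold_graph\<close> starts from one vertex but \<open>thr\<close>
    from none, so order 1 is the real base case.\<close>
  proof (cases "n = 0")
    case True
    have "A \<inter> {v} \<times> {v} = {}" using Suc.prems(4) by auto
    then have "threshold_graph \<lparr>pverts = {v}, parcs = A \<inter> {v} \<times> {v}\<rparr>"
      using threshold_graph.single[of v] by simp
    then show ?thesis using v(1) True by (intro exI[of _ "{v}"]) auto
  next
    case False
    from v(2) show ?thesis
    proof
      assume "thr ?E n (nb ?E v S)"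
      then obtain V where V: "V \<subseteq> nb ?E v S" "card V = n"
          "threshold_graph \<lparr>pverts = V, parcs = A \<inter> V \<times> V\<rparr>"
        using Suc.IH[OF _ finite_nb[OF Suc.prems(2)] False Suc.prems(4)] by blast
      have vV: "v \<notin> V" and arcs: "A \<inter> insert v V \<times> insert v V = A \<inter> V \<times> V \<union> {v} \<times> V \<union> V \<times> {v}"
        using V(1) Suc.prems(4) sympD[OF assms] by (auto simp: nb_def)
      have "finite V" using V(1) finite_nb[OF Suc.prems(2)] by (rule finite_subset)
      then have "card (insert v V) = Suc n" using vV V(2) by simp
      moreover have "threshold_graph \<lparr>pverts = insert v V, parcs = A \<inter> insert v V \<times> insert v V\<rparr>"
        using threshold_graph.add_dominating[OF V(3), of v] vV arcs by simp
      moreover have "insert v V \<subseteq> S" using V(1) v(1) by (auto simp: nb_def)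
      ultimately show ?thesis by blast
    next
      assume "thr ?E n (nb (compl_rel ?E) v S)"
      then obtain V where V: "V \<subseteq> nb (compl_rel ?E) v S" "card V = n"
          "threshold_graph \<lparr>pverts = V, parcs = A \<inter> V \<times> V\<rparr>"
        using Suc.IH[OF _ finite_nb[OF Suc.prems(2)] False Suc.prems(4)] by blast
      have vV: "v \<notin> V" and arcs: "A \<inter> insert v V \<times> insert v V = A \<inter> V \<times> V"
        using V(1) Suc.prems(4) sympD[OF assms] by (auto simp: nb_def)
      have "finite V" using V(1) finite_nb[OF Suc.prems(2)] by (rule finite_subset)
      then have "card (insert v V) = Suc n" using vV V(2) by simp
      moreover have "threshold_graph \<lparr>pverts = insert v V, parcs = A \<inter> insert v V \<times> insert v V\<rparr>"
        using threshold_graph.add_isolated[OF V(3), of v] vV arcs by simp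
      moreover have "insert v V \<subseteq> S" using V(1) v(1) by (auto simp: nb_def)
      ultimately show ?thesis by blast
    qed
  qed
qed simp

text \<open>Order 0 is excluded because \<open>thr E 0 S\<close> always holds, whereas a threshold
  graph has at least one vertex.\<close>

lemma contains_induced_threshold_iff_thr:
  assumes "pair_graph G" "s \<noteq> 0"
  shows "contains_induced_threshold G s \<longleftrightarrow> thr (\<lambda>u v. (u, v) \<in> parcs G) s (pverts G)"
proof -
  interpret pair_graph G by fact
  have symp: "symp (\<lambda>u v. (u, v) \<in> parcs G)"
    using sym_arcs by (auto simp: symp_def symmetric_def dest: symD)
  show ?thesis
  proof
    assume "contains_induced_threshold G s"
    then obtain H where H: "threshold_graph H" "card (pverts H) = s"
        "induced_subgraph (with_proj H) (with_proj G)"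
      by (auto simp: contains_induced_threshold_def)
    note thrH = threshold_graph_thr[OF H(1)]
    have sub: "pverts H \<subseteq> pverts G" and arcs: "parcs H = parcs G \<inter> pverts H \<times> pverts H"
      using H(3) by (auto simp: induced_subgraph_def subgraph_def)
    have "thr (\<lambda>u v. (u, v) \<in> parcs G) s (pverts H)"
      using thrH H(2) arcs by (subst thr_cong[where F = "\<lambda>u v. (u, v) \<in> parcs H"]) auto
    then show "thr (\<lambda>u v. (u, v) \<in> parcs G) s (pverts G)" using thr_mono sub by blast
  next
    assume "thr (\<lambda>u v. (u, v) \<in> parcs G) s (pverts G)"
    moreover have "(x, x) \<notin> parcs G" for x using pair_no_loops[of "(x, x)"] by auto
    ultimately obtain V where V: "V \<subseteq> pverts G" "card V = s"
        "threshold_graph \<lparr>pverts = V, parcs = parcs G \<inter> V \<times> V\<rparr>" (is "threshold_graph ?H")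
      using thr_threshold_graph[OF symp _ pair_finite_verts assms(2)] by metis
    have "wf_digraph (with_proj ?H)" by (simp add: wf_digraph_def)
    then have "induced_subgraph (with_proj ?H) (with_proj G)"
      using V(1) wf_digraph_axioms
      by (auto simp: induced_subgraph_def subgraph_def compatible_def)
    then show "contains_induced_threshold G s"
      unfolding contains_induced_threshold_def using V(2,3) by (intro exI[of _ ?H]) simp
  qed
qed

section \<open>Exhaustive search in the Paley graph on 17 vertices\<close>

fun thr_list :: "('a \<Rightarrow> 'a \<Rightarrow> bool) \<Rightarrow> nat \<Rightarrow> 'a list \<Rightarrow> bool" where
  "thr_list E 0 xs \<longleftrightarrow> True"
| "thr_list E (Suc n) xs \<longleftrightarrow> n < length xs \<and>
    list_ex (\<lambda>v. thr_list E n (filter (\<lambda>u. u \<noteq> v \<and> E v u) xs) \<or>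
      thr_list E n (filter (\<lambda>u. u \<noteq> v \<and> \<not> E v u) xs)) xs"

text \<open>Lets an evaluation of \<open>thr_list\<close> to \<open>False\<close> refute
  \<open>thr\<close>.\<close>

lemma thr_imp_thr_list: "thr E n (set xs) \<Longrightarrow> thr_list E n xs"
proof (induction n arbitrary: xs)
  case (Suc n)
  have nb: "nb F v (set xs) = set (filter (\<lambda>u. u \<noteq> v \<and> F v u) xs)" for F v
    by (auto simp: nb_def)
  obtain v where "v \<in> set xs" "thr E n (nb E v (set xs)) \<or> thr E n (nb (compl_rel E) v (set xs))"
    using Suc.prems unfolding thr.simps by blast
  moreover have "n < length xs"
    using thr_card[OF Suc.prems] card_length[of xs] by simp
  ultimately show ?case unfolding nb thr_list.simps list_ex_iff using Suc.IH by blast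
qed simp

text \<open>
  With truncated subtraction, \<^term>\<open>(u - v) + (v - u)\<close> is the distance of \<open>u\<close> and \<open>v\<close>. Since -1 is a
  square modulo 17, it may replace the difference in the definition of the Paley graph.
\<close>

definition paley17 :: "nat \<Rightarrow> nat \<Rightarrow> bool" where
  "paley17 u v \<longleftrightarrow> (u - v) + (v - u) \<in> set [1, 2, 4, 8, 9, 13, 15, 16]"

lemma symp_paley17: "symp paley17"
  by (auto simp: symp_def paley17_def add.commute)

lemma not_paley17_refl: "\<not> paley17 u u"
  by (simp add: paley17_def)

lemma not_thr_paley17: "\<not> thr paley17 6 {..<17}"
proof -
  have "\<not> thr_list paley17 6 [0..<17]" by code_simp
  then show ?thesis using thr_imp_thr_list[of paley17 6 "[0..<17]"] by (auto simp: atLeast0LessThan)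
qed

text \<open>The minimum in \<open>r2'\<close> requires a counterexample of every order below 18.
  Induced subgraphs inherit \<open>T\<^sub>6\<close>-freeness, so the first \<open>m\<close>
  vertices of the Paley graph provide one.\<close>

lemma paley17_graph:
  fixes m :: nat
  assumes "m < 18"
  defines "A \<equiv> {(u, v). u < m \<and> v < m \<and> paley17 u v}"
  shows "pair_graph \<lparr>pverts = {..<m}, parcs = A\<rparr>"
    and "\<not> contains_induced_threshold \<lparr>pverts = {..<m}, parcs = A\<rparr> 6"
proof -
  let ?G = "\<lparr>pverts = {..<m}, parcs = A\<rparr>"
  have sub: "A \<subseteq> {..<m} \<times> {..<m}" by (auto simp: A_def)
  then have fin: "finite A" by (rule finite_subset) simp
  have symA: "sym A"
    unfolding A_def by (rule symI) (use sympD[OF symp_paley17] in blast)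
  have irrefl: "(u, u) \<notin> A" for u
    unfolding A_def using not_paley17_refl by blast
  show G: "pair_graph ?G"
    by unfold_locales (use sub fin symA irrefl in \<open>auto simp: symmetric_def\<close>)
  have "\<not> thr paley17 6 {..<m}"
  proof
    assume "thr paley17 6 {..<m}"
    moreover have "{..<m} \<subseteq> {..<17}" using assms(1) by auto
    ultimately show False using not_thr_paley17 thr_mono[of paley17 6 "{..<m}" "{..<17}"] by blast
  qed
  moreover have "thr (\<lambda>u v. (u, v) \<in> A) 6 {..<m} = thr paley17 6 {..<m}"
    by (rule thr_cong) (simp add: A_def)
  ultimately show "\<not> contains_induced_threshold ?G 6"
    using contains_induced_threshold_iff_thr[OF G, of 6] by simp
qed

theorem theorem3p16:
  shows "r2' 6 = 18"
  unfolding r2'_def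
proof (rule Least_equality)
  show "\<forall>G :: nat pair_pre_digraph. pair_graph G \<and> card (pverts G) = 18 \<longrightarrow> contains_induced_threshold G 6"
  proof (intro allI impI)
    fix G :: "nat pair_pre_digraph"
    assume G: "pair_graph G \<and> card (pverts G) = 18"
    then interpret pair_graph G by simp
    have "symp (\<lambda>u v. (u, v) \<in> parcs G)"
      using sym_arcs by (auto simp: symp_def symmetric_def dest: symD)
    from thr_6[OF this] show "contains_induced_threshold G 6"
      using contains_induced_threshold_iff_thr[of G 6] G by simp
  qed
next
  fix n
  assume n: "\<forall>G :: nat pair_pre_digraph. pair_graph G \<and> card (pverts G) = n \<longrightarrow> contains_induced_threshold G 6"
  show "18 \<le> n"
  proof (rule ccontr)
    assume "\<not> 18 \<le> n"
    then have "n < 18" by simp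
    then show False
      using paley17_graph[of n] n[rule_format, OF conjI, OF paley17_graph(1)[of n]] by simp
  qed
qed

end
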